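(* Let $D\subset\mathbb{P}^2$ be a smooth conic in the complex projective plane, let $n\ge 0$ be an integer, and let $u_1,\dots,u_{2n+1}$ be involutions on $D$ with respective centers $c_1,\dots,c_{2n+1}\in\mathbb{P}^2\setminus D$. If $c_1,\dots,c_{2n+1}$ are aligned (all lie on one line), then the product $\prod_{i=1}^{2n+1}u_i=u_1u_2\cdots u_{2n+1}$ (composition) is an involution.
   Context: The smooth conic $D\subset\mathbb{P}^2$ is identified with $\mathbb{P}^1(\mathbb{C})$ via the Veronese embedding, so that $\mathrm{PGL}(2,\mathbb{C})$ is the automorphism group of $D$. An element $g\in\mathrm{PGL}(2,\mathbb{C})$ is called an involution if $g\neq I$ and $g^2=I$. An involution has exactly two fixed points on $D$; its center is the intersection point $x\notin D$ of the two tangent lines to $D$ at these fixed points. Equivalently, the involution with center $x\notin D$ exchanges the two intersection points with $D$ of each line through $x$ (a point of $D$ being fixed when the line is tangent there). *)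

theory Defs
  imports "HOL-Analysis.Analysis"
begin

subsection \<open>Complex projective spaces\<close>

definition proj_rel :: "complex ^ 'n \<Rightarrow> complex ^ 'n \<Rightarrow> bool" where
  "proj_rel v w \<longleftrightarrow> v \<noteq> 0 \<and> w \<noteq> 0 \<and> (\<exists>k. k \<noteq> 0 \<and> v = k *s w)"

lemma part_equivp_proj_rel: "part_equivp (proj_rel :: complex ^ 'n \<Rightarrow> _)"
proof (rule part_equivpI)
  show "\<exists>v :: complex ^ 'n. proj_rel v v"
    unfolding proj_rel_def
    by (intro exI[of _ "axis undefined 1"] conjI exI[of _ "1 :: complex"]) (auto simp: axis_eq_0_iff)
  show "symp (proj_rel :: complex ^ 'n \<Rightarrow> _)"
  proof (rule sympI)
    fix v w :: "complex ^ 'n"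
    assume "proj_rel v w"
    then obtain k where k: "v \<noteq> 0" "w \<noteq> 0" "k \<noteq> 0" "v = k *s w"
      by (auto simp: proj_rel_def)
    then have "inverse k \<noteq> 0" "w = inverse k *s v"
      by (simp_all add: vector_smult_assoc)
    with k show "proj_rel w v"
      unfolding proj_rel_def by blast
  qed
  show "transp (proj_rel :: complex ^ 'n \<Rightarrow> _)"
  proof (rule transpI)
    fix u v w :: "complex ^ 'n"
    assume "proj_rel u v" "proj_rel v w"
    then obtain k l where "u \<noteq> 0" "w \<noteq> 0" "k \<noteq> 0" "l \<noteq> 0" "u = k *s v" "v = l *s w"
      by (auto simp: proj_rel_def)
    then have "u \<noteq> 0" "w \<noteq> 0" "k * l \<noteq> 0" "u = (k * l) *s w"
      by (simp_all add: vector_smult_assoc)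
    then show "proj_rel u w"
      unfolding proj_rel_def by blast
  qed
qed

text \<open>Projective space of dimension \<open>CARD('n) - 1\<close>; thus \<open>2 proj\<close> is the projective line
  and \<open>3 proj\<close> the projective plane.\<close>

quotient_type 'n proj = "complex ^ 'n" / partial: proj_rel
  by (rule part_equivp_proj_rel)

subsection \<open>Projective linear groups\<close>

definition pgl_rel :: "complex ^ 'n ^ 'n \<Rightarrow> complex ^ 'n ^ 'n \<Rightarrow> bool" where
  "pgl_rel A B \<longleftrightarrow> invertible A \<and> invertible B \<and> (\<exists>k. k \<noteq> 0 \<and> A = map_matrix ((*) k) B)"

lemma scale_matrix_mult:
  fixes A B :: "complex ^ 'n ^ 'n"
  shows "map_matrix ((*) k) A ** map_matrix ((*) l) B = map_matrix ((*) (k * l)) (A ** B)"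
  by (simp add: vec_eq_iff map_matrix_def matrix_matrix_mult_def sum_distrib_left mult_ac)

lemma scale_matrix_vector_mult:
  fixes A :: "complex ^ 'n ^ 'n"
  shows "map_matrix ((*) k) A *v (l *s v) = (k * l) *s (A *v v)"
  by (simp add: vec_eq_iff map_matrix_def matrix_vector_mult_def sum_distrib_left mult_ac)

lemma invertible_mat_1: "invertible (mat 1 :: complex ^ 'n ^ 'n)"
  unfolding invertible_def by (rule exI[of _ "mat 1"]) simp

lemma pgl_rel_refl: "invertible A \<Longrightarrow> pgl_rel A A"
  unfolding pgl_rel_def
  by (intro conjI exI[of _ "1 :: complex"]) (simp_all add: vec_eq_iff map_matrix_def)

lemma part_equivp_pgl_rel: "part_equivp (pgl_rel :: complex ^ 'n ^ 'n \<Rightarrow> _)"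
proof (rule part_equivpI)
  show "\<exists>A :: complex ^ 'n ^ 'n. pgl_rel A A"
    using pgl_rel_refl invertible_mat_1 by blast
  show "symp (pgl_rel :: complex ^ 'n ^ 'n \<Rightarrow> _)"
  proof (rule sympI)
    fix A B :: "complex ^ 'n ^ 'n"
    assume "pgl_rel A B"
    then obtain k where k: "invertible A" "invertible B" "k \<noteq> 0" "A = map_matrix ((*) k) B"
      by (auto simp: pgl_rel_def)
    then have "inverse k \<noteq> 0" "B = map_matrix ((*) (inverse k)) A"
      by (simp_all add: vec_eq_iff map_matrix_def)
    with k show "pgl_rel B A"
      unfolding pgl_rel_def by blast
  qed
  show "transp (pgl_rel :: complex ^ 'n ^ 'n \<Rightarrow> _)"
  proof (rule transpI)
    fix A B C :: "complex ^ 'n ^ 'n"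
    assume "pgl_rel A B" "pgl_rel B C"
    then obtain k l where *: "invertible A" "invertible C" "k \<noteq> 0" "l \<noteq> 0"
      "A = map_matrix ((*) k) B" "B = map_matrix ((*) l) C"
      by (auto simp: pgl_rel_def)
    have "k * l \<noteq> 0" "A = map_matrix ((*) (k * l)) C"
      using *(3-) by (simp_all add: vec_eq_iff map_matrix_def)
    with *(1,2) show "pgl_rel A C"
      unfolding pgl_rel_def by blast
  qed
qed

quotient_type 'n pgl = "complex ^ 'n ^ 'n" / partial: pgl_rel
  by (rule part_equivp_pgl_rel)

instantiation pgl :: (finite) monoid_mult
begin

lift_definition one_pgl :: "'a pgl" is "mat 1"
  by (simp add: pgl_rel_refl invertible_mat_1)

lift_definition times_pgl :: "'a pgl \<Rightarrow> 'a pgl \<Rightarrow> 'a pgl" is "(**)"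
proof -
  fix A A' B B' :: "complex ^ 'a ^ 'a"
  assume "pgl_rel A A'" "pgl_rel B B'"
  then obtain k l where *: "invertible A" "invertible A'" "invertible B" "invertible B'"
    "k \<noteq> 0" "l \<noteq> 0" "A = map_matrix ((*) k) A'" "B = map_matrix ((*) l) B'"
    by (auto simp: pgl_rel_def)
  have "k * l \<noteq> 0" "A ** B = map_matrix ((*) (k * l)) (A' ** B')"
    using *(5-) by (simp_all add: scale_matrix_mult)
  moreover have "invertible (A ** B)" "invertible (A' ** B')"
    using *(1-4) invertible_mult by blast+
  ultimately show "pgl_rel (A ** B) (A' ** B')"
    unfolding pgl_rel_def by blast
qed

instance
proof
  fix a b c :: "'a pgl"
  show "a * b * c = a * (b * c)"
  proof transfer
    fix A B C :: "complex ^ 'a ^ 'a"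
    assume "pgl_rel A A" "pgl_rel B B" "pgl_rel C C"
    then have "invertible (A ** B ** C)"
      unfolding pgl_rel_def by (blast intro: invertible_mult)
    then show "pgl_rel (A ** B ** C) (A ** (B ** C))"
      by (simp add: matrix_mul_assoc pgl_rel_refl)
  qed
  show "1 * a = a"
    by transfer simp
  show "a * 1 = a"
    by transfer simp
qed

end

lift_definition pgl_act :: "'n::finite pgl \<Rightarrow> 'n proj \<Rightarrow> 'n proj"  (infixr \<open>\<cdot>\<close> 75) is "(*v)"
proof -
  fix A A' :: "complex ^ 'n ^ 'n" and v v' :: "complex ^ 'n"
  assume "pgl_rel A A'" "proj_rel v v'"
  then obtain k l where *: "invertible A" "invertible A'" "v \<noteq> 0" "v' \<noteq> 0"
    "k \<noteq> 0" "l \<noteq> 0" "A = map_matrix ((*) k) A'" "v = l *s v'"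
    by (auto simp: pgl_rel_def proj_rel_def)
  have nz: "M *v x \<noteq> 0" if M: "invertible M" and x: "x \<noteq> 0"
    for M :: "complex ^ 'n ^ 'n" and x
  proof
    assume 0: "M *v x = 0"
    from M obtain N where "N ** M = mat 1"
      unfolding invertible_def by blast
    then have "x = N *v (M *v x)"
      by (simp add: matrix_vector_mul_assoc)
    with 0 x show False by simp
  qed
  have "k * l \<noteq> 0" "A *v v = (k * l) *s (A' *v v')"
    using * by (simp_all add: scale_matrix_vector_mult)
  moreover have "A *v v \<noteq> 0" "A' *v v' \<noteq> 0"
    using * nz by blast+
  ultimately show "proj_rel (A *v v) (A' *v v')"
    unfolding proj_rel_def by blast
qed

definition involution :: "2 pgl \<Rightarrow> bool" where
  "involution g \<longleftrightarrow> g \<noteq> 1 \<and> g ^ 2 = 1"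

subsection \<open>Lines and conics in the projective plane\<close>

text \<open>The bilinear (not Hermitian) product.\<close>

definition dotp :: "complex ^ 'n \<Rightarrow> complex ^ 'n \<Rightarrow> complex" where
  "dotp v w = (\<Sum>i\<in>UNIV. v $ i * w $ i)"

lemma dotp_scale [simp]: "dotp (k *s v) w = k * dotp v w" "dotp v (k *s w) = k * dotp v w"
  by (simp_all add: dotp_def sum_distrib_left mult_ac)

lemma matrix_vector_scale: "(Q :: complex ^ 'n ^ 'n) *v (k *s v) = k *s (Q *v v)"
  by (simp add: vec_eq_iff matrix_vector_mult_def sum_distrib_left mult_ac)

text \<open>\<open>incident l x\<close>: the point \<open>x\<close> lies on the line \<open>l\<^sub>1 x\<^sub>1 + l\<^sub>2 x\<^sub>2 + l\<^sub>3 x\<^sub>3 = 0\<close>, where the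
  coefficients of the line are themselves only defined up to a nonzero scalar.\<close>

lift_definition incident :: "3 proj \<Rightarrow> 3 proj \<Rightarrow> bool" is "\<lambda>l x. dotp l x = 0"
  by (auto simp: proj_rel_def)

definition aligned :: "3 proj set \<Rightarrow> bool" where
  "aligned C \<longleftrightarrow> (\<exists>l. \<forall>c\<in>C. incident l c)"

text \<open>A conic is given by a quadratic form \<open>v \<mapsto> v\<^sup>T Q v\<close> with \<open>Q\<close> symmetric.
  The gradient of this form at \<open>v\<close> is \<open>2 Q v\<close>.\<close>

lift_definition on_conic :: "complex ^ 3 ^ 3 \<Rightarrow> 3 proj \<Rightarrow> bool" is
  "\<lambda>Q v. dotp v (Q *v v) = 0"
  by (auto simp: proj_rel_def matrix_vector_scale)

definition conic_points :: "complex ^ 3 ^ 3 \<Rightarrow> 3 proj set" where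
  "conic_points Q = {x. on_conic Q x}"

definition smooth_conic :: "complex ^ 3 ^ 3 \<Rightarrow> bool" where
  "smooth_conic Q \<longleftrightarrow>
     transpose Q = Q \<and> (\<forall>v. v \<noteq> 0 \<and> dotp v (Q *v v) = 0 \<longrightarrow> Q *v v \<noteq> 0)"

text \<open>The tangent line at a smooth point \<open>p\<close> of the conic is the line whose coefficients are the
  gradient of the form at \<open>p\<close>.\<close>

lift_definition on_tangent :: "complex ^ 3 ^ 3 \<Rightarrow> 3 proj \<Rightarrow> 3 proj \<Rightarrow> bool" is
  "\<lambda>Q p x. dotp (Q *v p) x = 0"
  by (auto simp: proj_rel_def matrix_vector_scale)

definition tangent_line :: "complex ^ 3 ^ 3 \<Rightarrow> 3 proj \<Rightarrow> 3 proj set" where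
  "tangent_line Q p = {x. on_tangent Q p x}"

subsection \<open>Identifying a smooth conic with the projective line\<close>

lift_definition veronese :: "2 proj \<Rightarrow> 3 proj" is
  "\<lambda>v. vector [(v $ 1)\<^sup>2, v $ 1 * v $ 2, (v $ 2)\<^sup>2]"
  apply (auto simp: proj_rel_def vec_eq_iff forall_2 forall_3)
  apply (auto simp: power2_eq_square algebra_simps)
  done

text \<open>The Veronese embedding in suitable projective coordinates of the plane, with image the given
  conic. It is unique up to precomposition with an element of \<open>2 pgl\<close>, so that the
  automorphisms of the conic are the maps induced by \<open>2 pgl\<close>, whatever the choice.\<close>

definition veronese_param :: "complex ^ 3 ^ 3 \<Rightarrow> (2 proj \<Rightarrow> 3 proj) \<Rightarrow> bool" where
  "veronese_param Q \<phi> \<longleftrightarrow> (\<exists>M :: 3 pgl. \<phi> = (\<lambda>p. M \<cdot> veronese p)) \<and> range \<phi> = conic_points Q"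

text \<open>\<open>c\<close> is the intersection of the tangent lines to the conic at the two fixed points of \<open>g\<close>,
  where \<open>g\<close> acts on the conic through the identification \<open>\<phi>\<close>.\<close>

definition is_center :: "complex ^ 3 ^ 3 \<Rightarrow> (2 proj \<Rightarrow> 3 proj) \<Rightarrow> 2 pgl \<Rightarrow> 3 proj \<Rightarrow> bool" where
  "is_center Q \<phi> g c \<longleftrightarrow>
     (\<exists>p q. p \<noteq> q \<and> {x. g \<cdot> x = x} = {p, q} \<and>
        tangent_line Q (\<phi> p) \<inter> tangent_line Q (\<phi> q) = {c})"

end

theory Submission
  imports Defs
begin

text \<open>
  An element of \<open>2 pgl\<close> is an involution exactly when its matrix is traceless
  (\<open>involution_iff_trace_eq_0\<close>), so everything happens in the three-dimensional space of traceless
  matrices. Via the Veronese parametrization, the center of the involution of a traceless \<open>A\<close> is the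
  image of \<open>A\<close> under a linear isomorphism from the traceless matrices to the plane's vector
  space (\<open>center_eq\<close>). Aligned centers therefore mean that the matrices lie in a plane
  of traceless matrices.

  Every such plane is the orthogonal complement, for the trace form, of a nonzero traceless
  matrix \<open>N\<close>. By Cayley--Hamilton \<open>AN + NA\<close> is the scalar \<open>tr(AN)\<close> for traceless \<open>A\<close> and \<open>N\<close>,
  so orthogonality to \<open>N\<close> is the same as anticommuting with \<open>N\<close>
  (\<open>anticommute_line_matrix\<close>). This property is multiplicative up to sign: a product of an odd
  number of matrices that anticommute with \<open>N\<close> anticommutes with \<open>N\<close> again
  (\<open>prod_list_anticommute\<close>). Finally, anticommuting with a nonzero traceless matrix
  forces the trace to vanish (\<open>trace_eq_0_if_anticommute\<close>), so the product is an involution.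

  The matrix \<open>N\<close> may be singular: this is the case of a line tangent to the conic, which
  needs no separate treatment.
\<close>

section \<open>Involutions are traceless matrices\<close>

lemma abs_pgl_surj:
  obtains A where "invertible A" "g = abs_pgl A"
  by (rule pgl.abs_induct[of "\<lambda>x. x = g \<longrightarrow> thesis", THEN mp, of g])
     (auto simp: pgl_rel_def that)

lemma abs_proj_surj:
  obtains v where "v \<noteq> 0" "p = abs_proj v"
  by (rule proj.abs_induct[of "\<lambda>x. x = p \<longrightarrow> thesis", THEN mp, of p])
     (auto simp: proj_rel_def that)

lemma proj_rel_refl: "v \<noteq> 0 \<Longrightarrow> proj_rel v v"
  unfolding proj_rel_def by (intro conjI exI[of _ 1]) auto

lemma abs_pgl_eq_iff:
  assumes "invertible A" "invertible B"
  shows "abs_pgl A = abs_pgl B \<longleftrightarrow> (\<exists>k. k \<noteq> 0 \<and> A = map_matrix ((*) k) B)"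
  using Quotient_rel[OF Quotient_pgl, of A B] assms by (simp add: pgl_rel_refl) (simp add: pgl_rel_def)

lemma abs_proj_eq_iff:
  assumes "v \<noteq> 0" "w \<noteq> 0"
  shows "abs_proj v = abs_proj w \<longleftrightarrow> (\<exists>k. k \<noteq> 0 \<and> v = k *s w)"
  using Quotient_rel[OF Quotient_proj, of v w] assms by (simp add: proj_rel_refl) (simp add: proj_rel_def)

lemma abs_pgl_mult:
  assumes "invertible A" "invertible B"
  shows "abs_pgl A * abs_pgl B = abs_pgl (A ** B)"
  using assms by (simp add: times_pgl.abs_eq pgl_rel_refl)

lemma abs_pgl_act:
  assumes "invertible A" "v \<noteq> 0"
  shows "abs_pgl A \<cdot> abs_proj v = abs_proj (A *v v)"
  using assms by (simp add: pgl_act.abs_eq pgl_rel_refl proj_rel_refl)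

lemma invertible_mult_vec_nonzero:
  fixes A :: "complex ^ 'n ^ 'n"
  assumes "invertible A" "v \<noteq> 0"
  shows "A *v v \<noteq> 0"
  by (metis assms invertible_def matrix_vector_mul_assoc matrix_vector_mul_lid matrix_vector_mult_0_right)

text \<open>By Cayley--Hamilton \<open>A\<^sup>2 = tr(A) A - det(A)\<close>, so \<open>A\<^sup>2\<close> is scalar exactly when \<open>A\<close> is
  scalar or traceless. An invertible matrix cannot be both, as its trace would be twice a nonzero
  scalar.\<close>

lemma involution_iff_trace_eq_0:
  fixes A :: "complex ^ 2 ^ 2"
  assumes A: "invertible A"
  shows "involution (abs_pgl A) \<longleftrightarrow> trace A = 0"
proof -
  define a b c d where abcd: "a = A $ 1 $ 1" "b = A $ 1 $ 2" "c = A $ 2 $ 1" "d = A $ 2 $ 2"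
  have det: "a * d - b * c \<noteq> 0"
    using A by (simp add: invertible_det_nz det_2 abcd)
  have AA: "invertible (A ** A)"
    using A by (simp add: invertible_mult)
  have one: "abs_pgl A = 1 \<longleftrightarrow> (\<exists>k. k \<noteq> 0 \<and> a = k \<and> b = 0 \<and> c = 0 \<and> d = k)"
    unfolding one_pgl.abs_eq abs_pgl_eq_iff[OF A invertible_mat_1]
    by (simp add: vec_eq_iff forall_2 map_matrix_def mat_def abcd)
  have sq: "abs_pgl A ^ 2 = 1 \<longleftrightarrow>
      (\<exists>k. k \<noteq> 0 \<and> a * a + b * c = k \<and> a * b + b * d = 0 \<and> c * a + d * c = 0 \<and> c * b + d * d = k)"
    unfolding power2_eq_square abs_pgl_mult[OF A A] one_pgl.abs_eq abs_pgl_eq_iff[OF AA invertible_mat_1]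
    by (simp add: vec_eq_iff forall_2 map_matrix_def mat_def abcd
        matrix_matrix_mult_def sum_2)
  have tr: "trace A = a + d"
    by (simp add: trace_def sum_2 abcd)
  show ?thesis
  proof
    assume inv: "involution (abs_pgl A)"
    show "trace A = 0"
    proof (rule ccontr)
      assume "trace A \<noteq> 0"
      then have ad: "a + d \<noteq> 0" by (simp add: tr)
      from inv obtain k where k: "k \<noteq> 0" "a * a + b * c = k" "a * b + b * d = 0"
        "c * a + d * c = 0" "c * b + d * d = k"
        unfolding involution_def sq by blast
      have b: "b * (a + d) = 0" using k(3) by algebra
      have c: "c * (a + d) = 0" using k(4) by algebra
      have "(a - d) * (a + d) = (a * a + b * c) - (c * b + d * d)"
        by (simp add: algebra_simps)
      then have "(a - d) * (a + d) = 0" by (simp add: k(2,5))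
      with b c have "b = 0" "c = 0" "a = d" using ad by simp_all
      moreover from this det have "a \<noteq> 0" by auto
      ultimately have "abs_pgl A = 1" unfolding one by blast
      with inv show False by (simp add: involution_def)
    qed
  next
    assume "trace A = 0"
    then have d: "d = - a" by (simp add: tr add_eq_0_iff)
    have "abs_pgl A \<noteq> 1" unfolding one by (auto simp: d)
    moreover have "abs_pgl A ^ 2 = 1"
      unfolding sq by (rule exI[of _ "a * a + b * c"]) (use det in \<open>auto simp: d algebra_simps add_eq_0_iff\<close>)
    ultimately show "involution (abs_pgl A)" by (simp add: involution_def)
  qed
qed

section \<open>Products of matrices that anticommute with a fixed one\<close>

definition anticommute :: "complex ^ 'n ^ 'n \<Rightarrow> complex ^ 'n ^ 'n \<Rightarrow> bool" where
  "anticommute A N \<longleftrightarrow> A ** N = - (N ** A)"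

lemma minus_matrix_mult:
  fixes A B :: "complex ^ 'n ^ 'n"
  shows "(- A) ** B = - (A ** B)" "A ** (- B) = - (A ** B)"
  by (simp_all add: vec_eq_iff matrix_matrix_mult_def sum_negf)

text \<open>Each factor moved past \<open>N\<close> contributes one sign, so only the parity of the number of factors
  matters.\<close>

lemma prod_list_anticommute:
  fixes N :: "complex ^ 'n ^ 'n"
  assumes "\<And>g. g \<in> set gs \<Longrightarrow> \<exists>A. invertible A \<and> g = abs_pgl A \<and> anticommute A N"
  shows "\<exists>X. invertible X \<and> prod_list gs = abs_pgl X \<and>
           (if even (length gs) then X ** N = N ** X else anticommute X N)"
  using assms
proof (induction gs)
  case Nil
  show ?case
    by (rule exI[of _ "mat 1"]) (simp add: invertible_mat_1 one_pgl.abs_eq)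
next
  case (Cons g gs)
  obtain A where A: "invertible A" "g = abs_pgl A" "A ** N = - (N ** A)"
    using Cons.prems[of g] by (auto simp: anticommute_def)
  obtain X where X: "invertible X" "prod_list gs = abs_pgl X"
    "if even (length gs) then X ** N = N ** X else X ** N = - (N ** X)"
    using Cons.IH Cons.prems unfolding anticommute_def by (meson list.set_intros(2))
  have "(A ** X) ** N = A ** (X ** N)"
    by (simp add: matrix_mul_assoc)
  also have "\<dots> = (if even (length gs) then (A ** N) ** X else - ((A ** N) ** X))"
    using X(3) by (simp add: minus_matrix_mult flip: matrix_mul_assoc split: if_splits)
  also have "\<dots> = (if even (length gs) then - (N ** (A ** X)) else N ** (A ** X))"
    by (simp add: A(3) minus_matrix_mult matrix_mul_assoc)
  finally have "(A ** X) ** N = \<dots>" .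
  then show ?case
    using A X by (intro exI[of _ "A ** X"])
      (auto simp: abs_pgl_mult invertible_mult anticommute_def)
qed

text \<open>Cayley--Hamilton in polarized form gives
  \<open>XN + NX = tr(X) N + tr(N) X + (tr(XN) - tr(X) tr(N)) I\<close>. If \<open>XN + NX = 0\<close> and \<open>tr(N) = 0\<close>, then
  \<open>tr(X) N\<close> is both scalar and traceless, hence zero. The equations in the proof are the
  entries of this identity.\<close>

lemma trace_eq_0_if_anticommute:
  fixes X N :: "complex ^ 2 ^ 2"
  assumes "anticommute X N" "trace N = 0" "N \<noteq> 0"
  shows "trace X = 0"
proof -
  define a b c d where abcd: "a = X $ 1 $ 1" "b = X $ 1 $ 2" "c = X $ 2 $ 1" "d = X $ 2 $ 2"
  define p q r where pqr: "p = N $ 1 $ 1" "q = N $ 1 $ 2" "r = N $ 2 $ 1"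
  have N22: "N $ 2 $ 2 = - p"
    using assms(2) by (simp add: trace_def sum_2 add_eq_0_iff pqr)
  have e: "a * p + b * r = - (p * a + q * c)" "a * q - b * p = - (p * b + q * d)"
    "c * p + d * r = - (r * a - p * c)" "c * q - d * p = - (r * b - p * d)"
    using assms(1)
    by (simp_all add: anticommute_def vec_eq_iff forall_2 matrix_matrix_mult_def sum_2 N22
        flip: abcd pqr)
  have "2 * ((a + d) * p) = 0"
    using e(1,4) by algebra
  moreover have "(a + d) * q = 0"
    using e(2) by algebra
  moreover have "(a + d) * r = 0"
    using e(3) by algebra
  moreover have "p \<noteq> 0 \<or> q \<noteq> 0 \<or> r \<noteq> 0"
    using assms(3) N22 by (auto simp: vec_eq_iff forall_2 pqr)
  ultimately show ?thesis
    by (auto simp: trace_def sum_2 abcd)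
qed

section \<open>The center of an involution\<close>

definition veronese_vec :: "complex ^ 2 \<Rightarrow> complex ^ 3" where
  "veronese_vec v = vector [(v $ 1)\<^sup>2, v $ 1 * v $ 2, (v $ 2)\<^sup>2]"

lemma veronese_vec_nonzero: "v \<noteq> 0 \<Longrightarrow> veronese_vec v \<noteq> 0"
  by (auto simp: veronese_vec_def vec_eq_iff forall_2 forall_3)

lemma veronese_abs: "v \<noteq> 0 \<Longrightarrow> veronese (abs_proj v) = abs_proj (veronese_vec v)"
  unfolding veronese_vec_def by (simp add: veronese.abs_eq proj_rel_refl)

lemma dotp_matrix_left: "dotp (A *v v) w = dotp v (transpose A *v w)"
  for A :: "complex ^ 'n ^ 'n"
  unfolding dotp_def matrix_vector_mult_def transpose_def
  by (simp add: sum_distrib_left sum_distrib_right mult_ac) (rule sum.swap)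

lemma dotp_commute: "dotp v w = dotp w v"
  by (simp add: dotp_def mult.commute)

text \<open>Pulled back to the standard coordinates, the equation of the conic vanishes on all points
  \<open>(x\<^sup>2, x y, y\<^sup>2)\<close>, hence is a multiple of \<open>2 (z\<^sub>1 z\<^sub>3 - z\<^sub>2\<^sup>2)\<close>; the right-hand side is the
  associated bilinear form with one argument on the Veronese conic, i.e. the equation of
  the tangent line there.\<close>

lemma symmetric_vanishing_on_veronese:
  fixes R :: "complex ^ 3 ^ 3"
  assumes sym: "transpose R = R"
    and vanish: "\<And>v. v \<noteq> 0 \<Longrightarrow> dotp (veronese_vec v) (R *v veronese_vec v) = 0"
  shows "dotp (R *v veronese_vec v) y =
    R $ 1 $ 3 * ((v $ 2)\<^sup>2 * y $ 1 - 2 * v $ 1 * v $ 2 * y $ 2 + (v $ 1)\<^sup>2 * y $ 3)"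
proof -
  have "R $ j $ i = R $ i $ j" for i j
    using arg_cong[OF sym, of "\<lambda>A. A $ i $ j"] by (simp add: transpose_def)
  note s = this[of 2 1] this[of 3 1] this[of 3 2]
  \<comment> \<open>A binary quartic that vanishes identically; its coefficients are found from its values at
    \<open>(1,0)\<close>, \<open>(0,1)\<close>, \<open>(1,1)\<close>, \<open>(1,-1)\<close> and \<open>(1,2)\<close>.\<close>
  have form: "R $ 1 $ 1 * x^4 + 2 * R $ 1 $ 2 * x^3 * y + (2 * R $ 1 $ 3 + R $ 2 $ 2) * x^2 * y^2
      + 2 * R $ 2 $ 3 * x * y^3 + R $ 3 $ 3 * y^4 = 0" if "x \<noteq> 0 \<or> y \<noteq> 0" for x y
  proof -
    have "(vector [x, y] :: complex ^ 2) \<noteq> 0"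
      using that by (auto simp: vec_eq_iff forall_2)
    from vanish[OF this] show ?thesis
      by (simp add: dotp_def veronese_vec_def matrix_vector_mult_def sum_3 s
          power2_eq_square power3_eq_cube power4_eq_xxxx algebra_simps)
  qed
  have 1: "R $ 1 $ 1 = 0" using form[of 1 0] by simp
  have 3: "R $ 3 $ 3 = 0" using form[of 0 1] by simp
  have p: "2 * R $ 1 $ 2 + (2 * R $ 1 $ 3 + R $ 2 $ 2) + 2 * R $ 2 $ 3 = 0"
    using form[of 1 1] by (simp add: 1 3)
  have m: "- 2 * R $ 1 $ 2 + (2 * R $ 1 $ 3 + R $ 2 $ 2) - 2 * R $ 2 $ 3 = 0"
    using form[of 1 "-1"] by (simp add: 1 3)
  have t: "4 * R $ 1 $ 2 + 4 * (2 * R $ 1 $ 3 + R $ 2 $ 2) + 16 * R $ 2 $ 3 = 0"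
    using form[of 1 2] by (simp add: 1 3 mult.commute)
  have "2 * (2 * R $ 1 $ 3 + R $ 2 $ 2) = 0"
    using arg_cong2[OF p m, of "(+)"] by (simp add: algebra_simps)
  then have mid: "2 * R $ 1 $ 3 + R $ 2 $ 2 = 0"
    by (simp only: mult_eq_0_iff) simp
  then have 22: "R $ 2 $ 2 = - 2 * R $ 1 $ 3"
    by (simp add: add_eq_0_iff)
  have 12: "R $ 1 $ 2 = - R $ 2 $ 3"
    using p mid by (simp add: algebra_simps add_eq_0_iff)
  have 23: "R $ 2 $ 3 = 0"
    using t mid by (simp add: 12)
  show ?thesis
    by (simp add: dotp_def veronese_vec_def matrix_vector_mult_def sum_3 s 1 3 23 12 22
        algebra_simps)
qed

text \<open>A point \<open>(x, y)\<close> is fixed by a traceless \<open>A\<close> iff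
  \<open>A\<^sub>1\<^sub>2 y\<^sup>2 + 2 A\<^sub>1\<^sub>1 x y - A\<^sub>2\<^sub>1 x\<^sup>2 = 0\<close>. The following vector is the one whose pairing
  \<open>y\<^sup>2 z\<^sub>1 - 2 x y z\<^sub>2 + x\<^sup>2 z\<^sub>3\<close> with the tangent line at \<open>(x\<^sup>2, x y, y\<^sup>2)\<close> is that quadratic form.\<close>

definition center_vec :: "complex ^ 2 ^ 2 \<Rightarrow> complex ^ 3" where
  "center_vec A = vector [A $ 1 $ 2, - A $ 1 $ 1, - A $ 2 $ 1]"

text \<open>The equation of the fixed points of \<open>A\<close> says that \<open>center_vec A\<close> lies on the tangent line at
  each of them. As the two tangent lines meet in a single point, that point is the center.\<close>

lemma center_eq:
  fixes Q M :: "complex ^ 3 ^ 3"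
  assumes Q: "transpose Q = Q"
    and M: "invertible M"
    and range: "range (\<lambda>p. abs_pgl M \<cdot> veronese p) \<subseteq> conic_points Q"
    and A: "invertible A" "trace A = 0"
    and c: "is_center Q (\<lambda>p. abs_pgl M \<cdot> veronese p) (abs_pgl A) c"
  shows "center_vec A \<noteq> 0" "c = abs_proj (M *v center_vec A)"
proof -
  have A22: "A $ 2 $ 2 = - A $ 1 $ 1"
    using A(2) by (simp add: trace_def sum_2 add_eq_0_iff)
  show nz: "center_vec A \<noteq> 0"
  proof
    assume "center_vec A = 0"
    then have "det A = 0"
      by (simp add: center_vec_def vec_eq_iff forall_3 det_2 A22)
    with A(1) show False by (simp add: invertible_det_nz)
  qed
  have Mv: "abs_pgl M \<cdot> veronese (abs_proj v) = abs_proj (M *v veronese_vec v)"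
    "M *v veronese_vec v \<noteq> 0" if "v \<noteq> 0" for v
    using that by (simp_all add: veronese_abs abs_pgl_act M veronese_vec_nonzero
        invertible_mult_vec_nonzero)
  \<comment> \<open>The matrix of the conic in the coordinates in which it is parametrized by \<open>veronese_vec\<close>.\<close>
  define R where "R = transpose M ** Q ** M"
  have R: "dotp (Q *v (M *v v)) (M *v w) = dotp (R *v v) w" for v w
    by (simp add: R_def dotp_matrix_left matrix_vector_mul_assoc matrix_transpose_mul
        transpose_transpose matrix_mul_assoc Q)
  have "transpose R = R"
    by (simp add: R_def matrix_transpose_mul Q matrix_mul_assoc)
  moreover have "dotp (veronese_vec v) (R *v veronese_vec v) = 0" if "v \<noteq> 0" for v
  proof -
    have "on_conic Q (abs_proj (M *v veronese_vec v))"
      using range that by (auto simp: conic_points_def Mv(1)[symmetric])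
    then have "dotp (Q *v (M *v veronese_vec v)) (M *v veronese_vec v) = 0"
      using Mv(2)[OF that] by (simp add: on_conic.abs_eq proj_rel_refl dotp_commute)
    then show ?thesis by (simp add: R dotp_commute[of "veronese_vec v"])
  qed
  ultimately have polar: "dotp (R *v veronese_vec v) y =
      R $ 1 $ 3 * ((v $ 2)\<^sup>2 * y $ 1 - 2 * v $ 1 * v $ 2 * y $ 2 + (v $ 1)\<^sup>2 * y $ 3)" for v y
    by (rule symmetric_vanishing_on_veronese)
  have tangent: "abs_proj (M *v center_vec A) \<in> tangent_line Q (abs_pgl M \<cdot> veronese p)"
    if fixed: "abs_pgl A \<cdot> p = p" for p
  proof -
    obtain v where v: "v \<noteq> 0" "p = abs_proj v" by (rule abs_proj_surj)
    from fixed v A(1) obtain k where "A *v v = k *s v"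
      by (auto simp: abs_pgl_act abs_proj_eq_iff invertible_mult_vec_nonzero)
    then have "A $ 1 $ 1 * v $ 1 + A $ 1 $ 2 * v $ 2 = k * v $ 1"
      "A $ 2 $ 1 * v $ 1 - A $ 1 $ 1 * v $ 2 = k * v $ 2"
      by (simp_all add: vec_eq_iff forall_2 matrix_vector_mult_def sum_2 A22)
    then have "(v $ 2)\<^sup>2 * A $ 1 $ 2 + 2 * v $ 1 * v $ 2 * A $ 1 $ 1 - (v $ 1)\<^sup>2 * A $ 2 $ 1 = 0"
      by algebra
    then have "dotp (Q *v (M *v veronese_vec v)) (M *v center_vec A) = 0"
      by (simp add: R polar center_vec_def)
    then show ?thesis
      using v nz M by (simp add: tangent_line_def Mv on_tangent.abs_eq proj_rel_refl
          invertible_mult_vec_nonzero)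
  qed
  from c obtain p q where pq: "{x. abs_pgl A \<cdot> x = x} = {p, q}"
    "tangent_line Q (abs_pgl M \<cdot> veronese p) \<inter> tangent_line Q (abs_pgl M \<cdot> veronese q) = {c}"
    unfolding is_center_def by blast
  have "abs_pgl A \<cdot> p = p" "abs_pgl A \<cdot> q = q" using pq(1) by auto
  then have "abs_proj (M *v center_vec A) \<in> {c}"
    unfolding pq(2)[symmetric] by (intro IntI tangent)
  then show "c = abs_proj (M *v center_vec A)" by simp
qed

section \<open>Aligned centers\<close>

text \<open>The line with coefficients \<open>m\<close>, written as a plane of traceless matrices: for traceless \<open>A\<close>
  the trace of \<open>A ** line_matrix m\<close> is \<open>2 * dotp m (center_vec A)\<close>.\<close>

definition line_matrix :: "complex ^ 3 \<Rightarrow> complex ^ 2 ^ 2" where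
  "line_matrix m = vector [vector [- m $ 2, - 2 * m $ 3], vector [2 * m $ 1, m $ 2]]"

lemma trace_line_matrix: "trace (line_matrix m) = 0"
  by (simp add: trace_def sum_2 line_matrix_def)

lemma line_matrix_nonzero: "m \<noteq> 0 \<Longrightarrow> line_matrix m \<noteq> 0"
  by (auto simp: line_matrix_def vec_eq_iff forall_2 forall_3)

text \<open>For traceless \<open>A\<close> and \<open>N\<close>, the matrix \<open>AN + NA\<close> is the scalar \<open>tr(AN)\<close>, which for
  \<open>N = line_matrix m\<close> is zero exactly when the center of \<open>A\<close> lies on the line \<open>m\<close>.\<close>

lemma anticommute_line_matrix:
  assumes "trace A = 0" "dotp m (center_vec A) = 0"
  shows "anticommute A (line_matrix m)"
proof -
  have A22: "A $ 2 $ 2 = - A $ 1 $ 1"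
    using assms(1) by (simp add: trace_def sum_2 add_eq_0_iff)
  have "m $ 1 * A $ 1 $ 2 - m $ 2 * A $ 1 $ 1 - m $ 3 * A $ 2 $ 1 = 0"
    using assms(2) by (simp add: dotp_def sum_3 center_vec_def)
  then show ?thesis
    unfolding anticommute_def vec_eq_iff forall_2
    by (simp add: matrix_matrix_mult_def sum_2 line_matrix_def A22; algebra)
qed

theorem proposition2p6:
  fixes Q :: "complex ^ 3 ^ 3"
    and \<phi> :: "2 proj \<Rightarrow> 3 proj"
    and n :: nat
    and u :: "nat \<Rightarrow> 2 pgl"
    and c :: "nat \<Rightarrow> 3 proj"
  assumes "smooth_conic Q"
    and "veronese_param Q \<phi>"
    and "\<And>i. i \<in> {1..2 * n + 1} \<Longrightarrow> involution (u i)"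
    and "\<And>i. i \<in> {1..2 * n + 1} \<Longrightarrow> c i \<notin> conic_points Q"
    and "\<And>i. i \<in> {1..2 * n + 1} \<Longrightarrow> is_center Q \<phi> (u i) (c i)"
    and "aligned (c ` {1..2 * n + 1})"
  shows "involution (prod_list (map u [1..<2 * n + 2]))"
proof -
  have Q: "transpose Q = Q" using assms(1) by (simp add: smooth_conic_def)
  obtain M where M: "invertible M" and \<phi>: "\<phi> = (\<lambda>p. abs_pgl M \<cdot> veronese p)"
    and range: "range \<phi> \<subseteq> conic_points Q"
    using assms(2) unfolding veronese_param_def by (metis abs_pgl_surj order_refl)
  obtain l where l: "l \<noteq> 0" "\<And>i. i \<in> {1..2 * n + 1} \<Longrightarrow> incident (abs_proj l) (c i)"
    using assms(6) unfolding aligned_def by (metis abs_proj_surj imageI)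
  \<comment> \<open>The common line, in the coordinates in which the conic is the standard Veronese one.\<close>
  define m where "m = transpose M *v l"
  define N where "N = line_matrix m"
  have "m \<noteq> 0"
    unfolding m_def using l(1) M
    by (intro invertible_mult_vec_nonzero) (simp_all add: invertible_det_nz)
  then have N: "trace N = 0" "N \<noteq> 0"
    by (simp_all add: N_def trace_line_matrix line_matrix_nonzero)
  have "\<exists>A. invertible A \<and> u i = abs_pgl A \<and> anticommute A N" if i: "i \<in> {1..2 * n + 1}" for i
  proof -
    obtain A where A: "invertible A" "u i = abs_pgl A" by (rule abs_pgl_surj)
    have tr: "trace A = 0"
      using assms(3)[OF i] A by (simp add: involution_iff_trace_eq_0)
    note c = center_eq[OF Q M range[unfolded \<phi>] A(1) tr assms(5)[OF i, unfolded A(2) \<phi>]]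
    have "dotp l (M *v center_vec A) = 0"
      using l(2)[OF i] l(1) c M
      by (simp add: incident.abs_eq proj_rel_refl invertible_mult_vec_nonzero)
    then have "dotp m (center_vec A) = 0"
      by (simp only: m_def dotp_matrix_left transpose_transpose)
    with tr have "anticommute A N" unfolding N_def by (rule anticommute_line_matrix)
    with A show ?thesis by blast
  qed
  moreover define gs where "gs = map u [1..<2 * n + 2]"
  ultimately have "\<exists>A. invertible A \<and> g = abs_pgl A \<and> anticommute A N" if "g \<in> set gs" for g
    using that by (auto simp: gs_def)
  from prod_list_anticommute[OF this] obtain X where X: "invertible X" "prod_list gs = abs_pgl X"
    "if even (length gs) then X ** N = N ** X else anticommute X N"
    by blast
  have "odd (length gs)" by (simp add: gs_def)
  with X(3) have "anticommute X N" by simp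
  then have "trace X = 0" using N by (rule trace_eq_0_if_anticommute)
  with X(1) have "involution (prod_list gs)" unfolding X(2) by (simp add: involution_iff_trace_eq_0)
  then show ?thesis by (simp only: gs_def)
qed

end
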